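(* Let $p$ be a prime number with $p \equiv 1 \bmod 4$. Then the Markoff graph mod $p$ is not planar.
   Context: For a prime $p$, define maps $m_1, m_2, m_3 : \mathbb{F}_p^3 \to \mathbb{F}_p^3$ by $m_1(x,y,z) = (yz-x,y,z)$, $m_2(x,y,z) = (x,xz-y,z)$, $m_3(x,y,z) = (x,y,xy-z)$. These are involutions preserving the polynomial $x^2+y^2+z^2-xyz$. The Markoff graph mod $p$ is the graph whose vertices are the triples $(x,y,z) \in \mathbb{F}_p^3$ with $(x,y,z)\neq(0,0,0)$ and $x^2+y^2+z^2=xyz$ in $\mathbb{F}_p$, with an (undirected) edge joining each vertex $v$ to $m_j(v)$ for $j=1,2,3$. If $m_j(v)=v$ this edge is a self-edge (loop) at $v$; loops do not affect planarity. A graph is planar if it can be drawn in the plane without edges crossing. *)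

theory Defs
  imports "HOL-Analysis.Analysis" "HOL-Number_Theory.Residues"
begin

section \<open>Markoff graphs\<close>

type_synonym 'a triple = "'a \<times> 'a \<times> 'a"

fun markoff_m1 :: "('a, 'b) ring_scheme \<Rightarrow> 'a triple \<Rightarrow> 'a triple" where
  "markoff_m1 R (x, y, z) = (y \<otimes>\<^bsub>R\<^esub> z \<ominus>\<^bsub>R\<^esub> x, y, z)"

fun markoff_m2 :: "('a, 'b) ring_scheme \<Rightarrow> 'a triple \<Rightarrow> 'a triple" where
  "markoff_m2 R (x, y, z) = (x, x \<otimes>\<^bsub>R\<^esub> z \<ominus>\<^bsub>R\<^esub> y, z)"

fun markoff_m3 :: "('a, 'b) ring_scheme \<Rightarrow> 'a triple \<Rightarrow> 'a triple" where
  "markoff_m3 R (x, y, z) = (x, y, x \<otimes>\<^bsub>R\<^esub> y \<ominus>\<^bsub>R\<^esub> z)"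

definition markoff_verts :: "('a, 'b) ring_scheme \<Rightarrow> 'a triple set" where
  "markoff_verts R =
     {(x, y, z). x \<in> carrier R \<and> y \<in> carrier R \<and> z \<in> carrier R
        \<and> (x, y, z) \<noteq> (\<zero>\<^bsub>R\<^esub>, \<zero>\<^bsub>R\<^esub>, \<zero>\<^bsub>R\<^esub>)
        \<and> x [^]\<^bsub>R\<^esub> (2::nat) \<oplus>\<^bsub>R\<^esub> y [^]\<^bsub>R\<^esub> (2::nat) \<oplus>\<^bsub>R\<^esub> z [^]\<^bsub>R\<^esub> (2::nat)
            = x \<otimes>\<^bsub>R\<^esub> y \<otimes>\<^bsub>R\<^esub> z}"

text \<open>
  Undirected edges are sets of endpoints, so a loop at \<open>v\<close> is the singleton \<open>{v}\<close>.
  No parallel edges are lost: the three maps change different coordinates, hence two of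
  them can only agree at \<open>v\<close> if both fix \<open>v\<close>.
\<close>
definition markoff_edges :: "('a, 'b) ring_scheme \<Rightarrow> 'a triple set set" where
  "markoff_edges R =
     {{v, m v} | v m. v \<in> markoff_verts R \<and> m \<in> {markoff_m1 R, markoff_m2 R, markoff_m3 R}}"

section \<open>Planarity\<close>

text \<open>
  A drawing of the graph with vertex set \<open>V\<close> and edge set \<open>E\<close> in the plane (identified with
  the complex numbers) places the vertices at distinct points and draws every edge as an arc,
  that is, an injective continuous path, joining its two endpoints. An arc meets the vertices
  only in its endpoints, and two different arcs meet only in common endpoints.
\<close>
definition plane_drawing ::
    "'v set \<Rightarrow> 'v set set \<Rightarrow> ('v \<Rightarrow> complex) \<Rightarrow> ('v set \<Rightarrow> real \<Rightarrow> complex) \<Rightarrow> bool" where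
  "plane_drawing V E \<phi> \<gamma> \<longleftrightarrow>
     inj_on \<phi> V
   \<and> (\<forall>e\<in>E. arc (\<gamma> e) \<and> {pathstart (\<gamma> e), pathfinish (\<gamma> e)} = \<phi> ` e
             \<and> path_image (\<gamma> e) \<inter> \<phi> ` V \<subseteq> \<phi> ` e)
   \<and> (\<forall>e\<in>E. \<forall>e'\<in>E. e \<noteq> e' \<longrightarrow> path_image (\<gamma> e) \<inter> path_image (\<gamma> e') \<subseteq> \<phi> ` (e \<inter> e'))"

text \<open>
  Loops do not affect planarity, so only the edges with two distinct endpoints are drawn.
\<close>
definition planar_graph :: "'v set \<Rightarrow> 'v set set \<Rightarrow> bool" where
  "planar_graph V E \<longleftrightarrow> (\<exists>\<phi> \<gamma>. plane_drawing V {e \<in> E. card e = 2} \<phi> \<gamma>)"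

end

theory Submission
  imports Defs "HOL-Number_Theory.Euler_Criterion" "HOL-Complex_Analysis.Winding_Numbers"
begin

text \<open>
  When \<open>p \<equiv> 1\<close> modulo \<open>4\<close> there is an \<open>i\<close> with \<open>i\<^sup>2 = -1\<close> in the residue ring, and
  the Markoff graph then contains a small obstruction of the same shape for every such \<open>p\<close>. For
  signs \<open>s, t = \<plusminus>1\<close> the triples \<open>(s, ti, 0)\<close> form a 4-cycle under \<open>m\<^sub>1\<close> and \<open>m\<^sub>2\<close>, the triples
  \<open>(s, 0, sti)\<close> form a 4-cycle under \<open>m\<^sub>1\<close> and \<open>m\<^sub>3\<close>, and they are linked in pairs through
  \<open>(s, ti, sti)\<close>, by \<open>m\<^sub>3\<close> and \<open>m\<^sub>2\<close>. The links do not respect the cyclic orders of the two squares: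
  changing the sign \<open>s\<close> alone moves along a side of the first square, but it takes
  \<open>(s, 0, sti)\<close> to \<open>(-s, 0, -sti)\<close>, the opposite corner of the second square. These
  twelve vertices carry a subdivision of \<open>K\<^bsub>3,3\<^esub>\<close>; the lemma
  \<open>markoff_graph_not_planar\<close> exhibits it over any commutative ring with such an \<open>i\<close> in
  which \<open>1 \<noteq> -1\<close>.

  A subdivision of \<open>K\<^bsub>3,3\<^esub>\<close> is read as a theta graph, that is, three internally disjoint paths between
  two branch vertices \<open>u, v\<close>, together with a tripod: a third branch vertex \<open>c\<close> with a leg to an
  interior vertex of each path. In the plane this configuration is impossible
  (\<open>no_theta_curve_with_tripod\<close>). Winding numbers show that some arc of the theta curve runs
  inside the closed curve formed by the other two. That arc cuts the inside into two
  regions. The leg of \<open>c\<close> to this arc avoids the closed curve, so \<open>c\<close> lies in one of the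
  regions; but each region is bounded by only two of the arcs, and the leg of \<open>c\<close> to the
  remaining arc would have to leave the region without crossing them.
\<close>


section \<open>Theta curves in the plane\<close>

definition arc_between :: "(real \<Rightarrow> complex) \<Rightarrow> complex \<Rightarrow> complex \<Rightarrow> bool" where
  "arc_between g a b \<longleftrightarrow> arc g \<and> pathstart g = a \<and> pathfinish g = b"

lemma connected_subset_inside:
  assumes "connected S" and "S \<inter> X = {}" and "S \<inter> inside X \<noteq> {}"
  shows "S \<subseteq> inside X"
proof -
  obtain s where s: "s \<in> S" "s \<in> inside X"
    using assms(3) by blast
  have "S \<subseteq> connected_component_set (- X) s"
    using assms s by (intro connected_component_maximal) auto
  then show ?thesis
    using inside_same_component[OF _ s(2)] by blast
qed

lemma arc_between_distinct: "arc_between g a b \<Longrightarrow> a \<noteq> b"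
  using arc_distinct_ends[of g] by (auto simp: arc_between_def)

lemma arc_between_reversepath: "arc_between g a b \<Longrightarrow> arc_between (reversepath g) b a"
  by (simp add: arc_between_def arc_reversepath)

lemma arc_between_join:
  assumes "arc_between g a b" and "arc_between h b c"
    and "path_image g \<inter> path_image h \<subseteq> {b}"
  shows "arc_between (g +++ h) a c"
  using assms by (auto simp: arc_between_def intro!: arc_join)

lemma arc_pair_loop:
  assumes "arc_between f a b" and "arc_between g a b"
    and "path_image f \<inter> path_image g = {a, b}"
  shows "simple_path (f +++ reversepath g)"
    and "pathfinish (f +++ reversepath g) = pathstart (f +++ reversepath g)"
    and "path_image (f +++ reversepath g) = path_image f \<union> path_image g"
  using assms
  by (auto simp: arc_between_def path_image_join simple_path_join_loop_eq arc_reversepath)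

text \<open>
  The Jordan curve theorem, restated for two arcs with common endpoints, so that the arcs of a
  theta curve can be paired off without mentioning joins and reversals again.
\<close>
lemma arc_pair_Jordan:
  assumes "arc_between f a b" and "arc_between g a b"
    and "path_image f \<inter> path_image g = {a, b}"
  defines "S \<equiv> inside (path_image f \<union> path_image g)"
  shows "S \<noteq> {}" and "connected S" and "frontier S = path_image f \<union> path_image g"
  using Jordan_inside_outside[OF arc_pair_loop(1,2)[OF assms(1-3)]]
  unfolding arc_pair_loop(3)[OF assms(1-3)] S_def by auto

text \<open>
  A simple closed curve has winding number \<open>\<plusminus>1\<close> about its inside and \<open>0\<close> about its
  outside. Splitting the curve into two arcs turns this into a comparison of the winding numbers of
  the arcs, and equality of such numbers is transitive over the three arcs of a theta curve.
\<close>
lemma winding_number_arc_pair: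
  assumes "arc_between f a b" and "arc_between g a b"
    and "path_image f \<inter> path_image g = {a, b}"
    and "w \<notin> path_image f" and "w \<notin> path_image g"
  shows "winding_number f w = winding_number g w \<longleftrightarrow> w \<notin> inside (path_image f \<union> path_image g)"
proof -
  let ?c = "f +++ reversepath g"
  note loop = arc_pair_loop[OF assms(1-3)]
  have diff: "winding_number ?c w = winding_number f w - winding_number g w"
    using assms by (simp add: arc_between_def winding_number_join winding_number_reversepath
        arc_imp_path)
  have "winding_number ?c w \<noteq> 0" if "w \<in> inside (path_image ?c)"
    using simple_closed_path_winding_number_inside[OF loop(1)] that
    by (metis neg_equal_0_iff_equal zero_neq_one)
  moreover have "winding_number ?c w = 0" if "w \<notin> inside (path_image ?c)"
  proof (rule winding_number_zero_in_outside)
    show "w \<in> outside (path_image ?c)"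
      using that assms(4,5) loop(3) inside_Un_outside[of "path_image ?c"] by blast
  qed (use loop in \<open>auto simp: simple_path_imp_path\<close>)
  ultimately show ?thesis
    using diff loop(3) by auto
qed

text \<open>
  If the loops \<open>fg\<close> and \<open>gh\<close> had a common interior point although neither contains the third
  arc, then the inside of \<open>fg\<close>, being connected and disjoint from \<open>g\<close> and \<open>h\<close>, would
  lie in the inside of \<open>gh\<close>. Its boundary contains \<open>f\<close>, which would be forced into the
  closed region bounded by \<open>gh\<close>; but \<open>f\<close> avoids its interior and meets \<open>g\<close> and
  \<open>h\<close> only in the common endpoints.
\<close>
lemma inside_not_in_neighbouring_inside:
  assumes f: "arc_between f a b" and g: "arc_between g a b" and h: "arc_between h a b"
    and fg: "path_image f \<inter> path_image g = {a, b}"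
    and gh: "path_image g \<inter> path_image h = {a, b}"
    and fh: "path_image f \<inter> path_image h = {a, b}"
    and h_out: "path_image h \<inter> inside (path_image f \<union> path_image g) = {}"
    and f_out: "path_image f \<inter> inside (path_image g \<union> path_image h) = {}"
    and w: "w \<in> inside (path_image f \<union> path_image g)"
  shows "w \<notin> inside (path_image g \<union> path_image h)"
proof
  let ?I = "inside (path_image f \<union> path_image g)" and ?J = "inside (path_image g \<union> path_image h)"
  assume wJ: "w \<in> ?J"
  have "?I \<inter> (path_image g \<union> path_image h) = {}"
    using h_out inside_no_overlap[of "path_image f \<union> path_image g"] by blast
  then have "?I \<subseteq> ?J"
    using arc_pair_Jordan(2)[OF f g fg] w wJ by (intro connected_subset_inside) auto
  then have "closure ?I \<subseteq> closure ?J"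
    by (rule closure_mono)
  also have "closure ?J \<subseteq> path_image g \<union> path_image h \<union> ?J"
    using g h by (intro closure_inside_subset closed_Un closed_path_image)
      (auto simp: arc_between_def arc_imp_path)
  finally have "path_image f \<subseteq> path_image g \<union> path_image h \<union> ?J"
    using arc_pair_Jordan(3)[OF f g fg] by (auto simp: frontier_def)
  then have "path_image f \<subseteq> {a, b}"
    using f_out fg fh by blast
  moreover have "path_image f - {a, b} \<noteq> {}"
    using f nonempty_simple_path_endless[of f] by (auto simp: arc_between_def arc_imp_simple_path)
  ultimately show False
    by blast
qed

text \<open>
  Otherwise the three loops would have pairwise disjoint insides. A point inside \<open>fg\<close> would then
  lie outside \<open>gh\<close> and outside \<open>fh\<close>, so that both \<open>f\<close> and \<open>g\<close> would have the same
  winding number about it as \<open>h\<close>; but about a point inside \<open>fg\<close> these numbers differ.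
\<close>
lemma theta_curve_arc_inside:
  assumes f: "arc_between f a b" and g: "arc_between g a b" and h: "arc_between h a b"
    and fg: "path_image f \<inter> path_image g = {a, b}"
    and gh: "path_image g \<inter> path_image h = {a, b}"
    and hf: "path_image h \<inter> path_image f = {a, b}"
  shows "path_image f \<inter> inside (path_image g \<union> path_image h) \<noteq> {}
       \<or> path_image g \<inter> inside (path_image h \<union> path_image f) \<noteq> {}
       \<or> path_image h \<inter> inside (path_image f \<union> path_image g) \<noteq> {}"
proof (rule ccontr)
  assume "\<not> ?thesis"
  then have f_out: "path_image f \<inter> inside (path_image g \<union> path_image h) = {}"
    and g_out: "path_image g \<inter> inside (path_image h \<union> path_image f) = {}"
    and h_out: "path_image h \<inter> inside (path_image f \<union> path_image g) = {}"
    by auto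
  obtain w where w: "w \<in> inside (path_image f \<union> path_image g)"
    using arc_pair_Jordan(1)[OF f g fg] by blast
  then have off: "w \<notin> path_image f" "w \<notin> path_image g" "w \<notin> path_image h"
    using h_out inside_no_overlap[of "path_image f \<union> path_image g"] by blast+
  have "w \<notin> inside (path_image g \<union> path_image h)"
    using inside_not_in_neighbouring_inside[OF f g h] fg gh hf h_out f_out w
    by (simp add: Int_commute)
  then have "winding_number g w = winding_number h w"
    using winding_number_arc_pair[OF g h gh] off by blast
  moreover have "w \<notin> inside (path_image f \<union> path_image h)"
    using inside_not_in_neighbouring_inside[OF g f h] fg gh hf h_out g_out w
    by (simp add: Int_commute Un_commute)
  then have "winding_number f w = winding_number h w"
    using winding_number_arc_pair[OF f h] hf off by (simp add: Int_commute)
  ultimately show False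
    using winding_number_arc_pair[OF f g fg off(1,2)] w by simp
qed

text \<open>
  An arc \<open>h\<close> inside the loop \<open>fg\<close> divides it into the insides of \<open>fh\<close> and \<open>gh\<close>. The leg
  \<open>R\<close> puts \<open>c\<close> inside \<open>fg\<close>, hence inside \<open>fh\<close> or \<open>gh\<close>. The leg to the arc that does
  not bound this region stays in the region, and so strictly inside \<open>fg\<close>, although its end lies on
  the loop \<open>fg\<close>.
\<close>
lemma theta_inside_arc_no_tripod:
  assumes f: "arc_between f a b" and g: "arc_between g a b" and h: "arc_between h a b"
    and fg: "path_image f \<inter> path_image g = {a, b}"
    and gh: "path_image g \<inter> path_image h = {a, b}"
    and hf: "path_image h \<inter> path_image f = {a, b}"
    and P: "connected P" "c \<in> P" "P \<inter> path_image f \<noteq> {}" "P \<inter> (path_image g \<union> path_image h) = {}"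
    and Q: "connected Q" "c \<in> Q" "Q \<inter> path_image g \<noteq> {}" "Q \<inter> (path_image h \<union> path_image f) = {}"
    and R: "connected R" "c \<in> R" "R \<inter> path_image h \<noteq> {}" "R \<inter> (path_image f \<union> path_image g) = {}"
  shows "path_image h \<inter> inside (path_image f \<union> path_image g) = {}"
proof (rule ccontr)
  assume meets: "path_image h \<inter> inside (path_image f \<union> path_image g) \<noteq> {}"
  have simple: "simple_path f" "simple_path g" "simple_path h"
    and ends: "pathstart f = a" "pathstart g = a" "pathstart h = a"
      "pathfinish f = b" "pathfinish g = b" "pathfinish h = b"
    using f g h by (auto simp: arc_between_def arc_imp_simple_path)
  have split: "inside (path_image f \<union> path_image h) \<union> inside (path_image g \<union> path_image h)
      \<union> (path_image h - {a, b}) = inside (path_image f \<union> path_image g)"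
    by (rule split_inside_simple_closed_curve[of f a b g h])
      (use simple ends arc_between_distinct[OF f] fg gh hf meets in \<open>auto simp: Int_commute\<close>)
  obtain z where z: "z \<in> R" "z \<in> path_image h"
    using R(3) by blast
  have "z \<in> inside (path_image f \<union> path_image g)"
    using z R(4) fg split by blast
  then have "c \<in> inside (path_image f \<union> path_image g)"
    using connected_subset_inside[OF R(1) R(4)] z R(2) by blast
  moreover have "c \<notin> path_image h"
    using P(2,4) by blast
  ultimately consider "c \<in> inside (path_image f \<union> path_image h)"
    | "c \<in> inside (path_image g \<union> path_image h)"
    using split by blast
  then show False
  proof cases
    case 1
    then have "Q \<subseteq> inside (path_image f \<union> path_image g)"
      using connected_subset_inside[of Q "path_image f \<union> path_image h"] Q split by blast
    then show False
      using Q(3) inside_no_overlap[of "path_image f \<union> path_image g"] by blast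
  next
    case 2
    then have "P \<subseteq> inside (path_image f \<union> path_image g)"
      using connected_subset_inside[of P "path_image g \<union> path_image h"] P split by blast
    then show False
      using P(3) inside_no_overlap[of "path_image f \<union> path_image g"] by blast
  qed
qed

text \<open>
  This is the nonplanarity of \<open>K\<^bsub>3,3\<^esub>\<close>. The legs enter the argument only through the components of
  complements of loops, so they may be arbitrary connected sets, and they may meet each other.
\<close>
lemma no_theta_curve_with_tripod:
  assumes f: "arc_between f a b" and g: "arc_between g a b" and h: "arc_between h a b"
    and fg: "path_image f \<inter> path_image g = {a, b}"
    and gh: "path_image g \<inter> path_image h = {a, b}"
    and hf: "path_image h \<inter> path_image f = {a, b}"
    and P: "connected P" "c \<in> P" "P \<inter> path_image f \<noteq> {}" "P \<inter> (path_image g \<union> path_image h) = {}"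
    and Q: "connected Q" "c \<in> Q" "Q \<inter> path_image g \<noteq> {}" "Q \<inter> (path_image h \<union> path_image f) = {}"
    and R: "connected R" "c \<in> R" "R \<inter> path_image h \<noteq> {}" "R \<inter> (path_image f \<union> path_image g) = {}"
  shows False
  using theta_curve_arc_inside[OF f g h fg gh hf]
    theta_inside_arc_no_tripod[OF f g h fg gh hf P Q R]
    theta_inside_arc_no_tripod[OF g h f gh hf fg Q R P]
    theta_inside_arc_no_tripod[OF h f g hf fg gh R P Q]
  by blast


section \<open>Walks in a plane drawing\<close>

fun walk_edges :: "'v list \<Rightarrow> 'v set set" where
  "walk_edges (x # y # zs) = insert {x, y} (walk_edges (y # zs))"
| "walk_edges _ = {}"

text \<open>
  Walks have at least one edge: a walk with a single vertex would be drawn as the empty set, which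
  misses the point of its vertex.
\<close>
definition walk :: "'v set set \<Rightarrow> 'v \<Rightarrow> 'v list \<Rightarrow> 'v \<Rightarrow> bool" where
  "walk E u xs v \<longleftrightarrow> 2 \<le> length xs \<and> hd xs = u \<and> last xs = v \<and> walk_edges xs \<subseteq> E"

definition drawn :: "('v set \<Rightarrow> real \<Rightarrow> complex) \<Rightarrow> 'v list \<Rightarrow> complex set" where
  "drawn \<gamma> xs = (\<Union>e\<in>walk_edges xs. path_image (\<gamma> e))"

lemma walk_ends_in_set: "walk E u xs v \<Longrightarrow> u \<in> set xs \<and> v \<in> set xs"
  by (cases xs) (auto simp: walk_def)

lemma walk_edges_subset: "e \<in> walk_edges xs \<Longrightarrow> e \<subseteq> set xs"
  by (induction xs rule: walk_edges.induct) auto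

lemma walk_induct [consumes 1, case_names edge step]:
  assumes "walk E u xs v"
    and "\<And>u v. {u, v} \<in> E \<Longrightarrow> Q u [u, v] v"
    and "\<And>u w zs v. {u, w} \<in> E \<Longrightarrow> walk E w (w # zs) v \<Longrightarrow> Q w (w # zs) v \<Longrightarrow> Q u (u # w # zs) v"
  shows "Q u xs v"
  using assms(1)
proof (induction xs arbitrary: u rule: walk_edges.induct)
  case (1 x y zs)
  have x: "x = u" "{u, y} \<in> E"
    using "1.prems" by (auto simp: walk_def)
  show ?case
  proof (cases zs)
    case Nil
    then show ?thesis
      using "1.prems" x assms(2)[of u v] by (auto simp: walk_def)
  next
    case (Cons z zs')
    then have "walk E y (y # zs) v"
      using "1.prems" by (auto simp: walk_def)
    then show ?thesis
      using "1.IH" x assms(3)[of u y zs v] by simp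
  qed
qed (auto simp: walk_def)

lemma drawn_simps [simp]:
  "drawn \<gamma> [x, y] = path_image (\<gamma> {x, y})"
  "drawn \<gamma> (x # y # z # zs) = path_image (\<gamma> {x, y}) \<union> drawn \<gamma> (y # z # zs)"
  by (auto simp: drawn_def)

text \<open>
  This transfers disjointness from the graph to the drawing: walks without a common edge can be
  drawn with common points only at common vertices.
\<close>
lemma drawn_Int_subset:
  assumes "plane_drawing V E \<phi> \<gamma>"
    and "walk_edges xs \<subseteq> E" and "walk_edges ys \<subseteq> E"
    and "walk_edges xs \<inter> walk_edges ys = {}"
  shows "drawn \<gamma> xs \<inter> drawn \<gamma> ys \<subseteq> \<phi> ` (set xs \<inter> set ys)"
proof
  fix z assume "z \<in> drawn \<gamma> xs \<inter> drawn \<gamma> ys"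
  then obtain d e where de: "d \<in> walk_edges xs" "e \<in> walk_edges ys"
    "z \<in> path_image (\<gamma> d) \<inter> path_image (\<gamma> e)"
    by (auto simp: drawn_def)
  then have "d \<in> E" "e \<in> E" "d \<noteq> e"
    using assms(2-4) by auto
  then have "path_image (\<gamma> d) \<inter> path_image (\<gamma> e) \<subseteq> \<phi> ` (d \<inter> e)"
    using assms(1) unfolding plane_drawing_def by simp
  moreover have "d \<subseteq> set xs" "e \<subseteq> set ys"
    using de(1,2) by (auto dest: walk_edges_subset)
  ultimately show "z \<in> \<phi> ` (set xs \<inter> set ys)"
    using de(3) by blast
qed

text \<open>
  A drawing assigns one arc to each unordered edge, and its direction is unspecified. For a walk the
  arc must be traversable from either end.
\<close>
lemma edge_arc_between:
  assumes "plane_drawing V E \<phi> \<gamma>" and "{u, v} \<in> E"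
  obtains g where "arc_between g (\<phi> u) (\<phi> v)" and "path_image g = path_image (\<gamma> {u, v})"
proof -
  have arc: "arc (\<gamma> {u, v})"
    and "{pathstart (\<gamma> {u, v}), pathfinish (\<gamma> {u, v})} = {\<phi> u, \<phi> v}"
    using assms by (auto simp: plane_drawing_def)
  then consider "arc_between (\<gamma> {u, v}) (\<phi> u) (\<phi> v)" | "arc_between (\<gamma> {u, v}) (\<phi> v) (\<phi> u)"
    by (auto simp: arc_between_def doubleton_eq_iff)
  then show thesis
    by cases (use that arc_between_reversepath path_image_reversepath in metis)+
qed

lemma drawn_path_arc:
  assumes "plane_drawing V E \<phi> \<gamma>" and "walk E u xs v" and "distinct xs"
  obtains g where "arc_between g (\<phi> u) (\<phi> v)" and "path_image g = drawn \<gamma> xs"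
proof -
  have "\<exists>g. arc_between g (\<phi> u) (\<phi> v) \<and> path_image g = drawn \<gamma> xs"
    using assms(2,3)
  proof (induction rule: walk_induct)
    case (edge u v)
    then show ?case
      using edge_arc_between[OF assms(1)] by (metis drawn_simps(1))
  next
    case (step u w zs v)
    obtain h where h: "arc_between h (\<phi> w) (\<phi> v)" "path_image h = drawn \<gamma> (w # zs)"
      using step by auto
    obtain g where g: "arc_between g (\<phi> u) (\<phi> w)" "path_image g = drawn \<gamma> [u, w]"
      using edge_arc_between[OF assms(1) step(1)] by auto
    have "u \<notin> set (w # zs)"
      using \<open>distinct (u # w # zs)\<close> by simp
    then have "{u, w} \<notin> walk_edges (w # zs)"
      using walk_edges_subset by fastforce
    then have "drawn \<gamma> [u, w] \<inter> drawn \<gamma> (w # zs) \<subseteq> \<phi> ` (set [u, w] \<inter> set (w # zs))"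
      using step(1,2) by (intro drawn_Int_subset[OF assms(1)]) (auto simp: walk_def)
    also have "\<dots> \<subseteq> {\<phi> w}"
      using \<open>u \<notin> set (w # zs)\<close> by auto
    finally have "arc_between (g +++ h) (\<phi> u) (\<phi> v)"
      using g h by (intro arc_between_join) auto
    moreover have "path_image (g +++ h) = drawn \<gamma> (u # w # zs)"
      using g h step(2) by (cases zs) (auto simp: path_image_join arc_between_def walk_def)
    ultimately show ?case
      by blast
  qed
  then show thesis
    using that by blast
qed

lemma drawn_walk_connected:
  assumes "plane_drawing V E \<phi> \<gamma>" and "walk E u xs v"
  shows "connected (drawn \<gamma> xs)" and "\<phi> ` set xs \<subseteq> drawn \<gamma> xs"
proof -
  have single: "connected (drawn \<gamma> [u, v]) \<and> \<phi> ` {u, v} \<subseteq> drawn \<gamma> [u, v]"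
    if uv: "{u, v} \<in> E" for u v
  proof -
    obtain g where g: "arc_between g (\<phi> u) (\<phi> v)" "path_image g = path_image (\<gamma> {u, v})"
      using edge_arc_between[OF assms(1) uv] .
    then have "connected (path_image g) \<and> \<phi> u \<in> path_image g \<and> \<phi> v \<in> path_image g"
      using connected_path_image[of g] pathstart_in_path_image[of g] pathfinish_in_path_image[of g]
      by (auto simp only: arc_between_def arc_imp_path)
    then show ?thesis
      using g by simp
  qed
  have "connected (drawn \<gamma> xs) \<and> \<phi> ` set xs \<subseteq> drawn \<gamma> xs"
    using assms(2)
  proof (induction rule: walk_induct)
    case (edge u v)
    then show ?case
      using single[of u v] by simp
  next
    case (step u w zs v)
    have "drawn \<gamma> (u # w # zs) = drawn \<gamma> [u, w] \<union> drawn \<gamma> (w # zs)"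
      using step(2) by (cases zs) (auto simp: walk_def)
    moreover have "connected (drawn \<gamma> [u, w] \<union> drawn \<gamma> (w # zs))"
      using single[OF step(1)] step(3) by (intro connected_Un) auto
    ultimately show ?case
      using single[OF step(1)] step(3) by auto
  qed
  then show "connected (drawn \<gamma> xs)" and "\<phi> ` set xs \<subseteq> drawn \<gamma> xs"
    by auto
qed

text \<open>
  The paths are required to be edge-disjoint as well as internally disjoint, because two paths could
  otherwise both consist of the single edge \<open>{u, v}\<close>. A leg shares no vertex, and therefore no
  edge, with the two paths that it must avoid.
\<close>
lemma not_planar_if_theta_with_tripod:
  assumes A: "walk E u A v" "distinct A" and B: "walk E u B v" "distinct B"
    and C: "walk E u C v" "distinct C"
    and AB: "set A \<inter> set B = {u, v}" "walk_edges A \<inter> walk_edges B = {}"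
    and BC: "set B \<inter> set C = {u, v}" "walk_edges B \<inter> walk_edges C = {}"
    and CA: "set C \<inter> set A = {u, v}" "walk_edges C \<inter> walk_edges A = {}"
    and P: "walk E c P x" "x \<in> set A" "set P \<inter> (set B \<union> set C) = {}"
    and Q: "walk E c Q y" "y \<in> set B" "set Q \<inter> (set C \<union> set A) = {}"
    and R: "walk E c R z" "z \<in> set C" "set R \<inter> (set A \<union> set B) = {}"
  shows "\<not> plane_drawing V E \<phi> \<gamma>"
proof
  assume D: "plane_drawing V E \<phi> \<gamma>"
  obtain f where f: "arc_between f (\<phi> u) (\<phi> v)" "path_image f = drawn \<gamma> A"
    using drawn_path_arc[OF D A] .
  obtain g where g: "arc_between g (\<phi> u) (\<phi> v)" "path_image g = drawn \<gamma> B"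
    using drawn_path_arc[OF D B] .
  obtain h where h: "arc_between h (\<phi> u) (\<phi> v)" "path_image h = drawn \<gamma> C"
    using drawn_path_arc[OF D C] .
  have vertices: "\<phi> w \<in> drawn \<gamma> X" if "walk E s X t" "w \<in> set X" for w X s t
    using drawn_walk_connected(2)[OF D that(1)] that(2) by blast
  have theta: "drawn \<gamma> X \<inter> drawn \<gamma> Y = {\<phi> u, \<phi> v}"
    if X: "walk E u X v" and Y: "walk E u Y v"
      and XY: "set X \<inter> set Y = {u, v}" "walk_edges X \<inter> walk_edges Y = {}" for X Y
  proof
    show "drawn \<gamma> X \<inter> drawn \<gamma> Y \<subseteq> {\<phi> u, \<phi> v}"
      using drawn_Int_subset[OF D, of X Y] X Y XY by (simp add: walk_def)
    show "{\<phi> u, \<phi> v} \<subseteq> drawn \<gamma> X \<inter> drawn \<gamma> Y"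
      using vertices[OF X] vertices[OF Y] walk_ends_in_set[OF X] walk_ends_in_set[OF Y] by simp
  qed
  have disjoint: "drawn \<gamma> X \<inter> drawn \<gamma> Y = {}"
    if "walk E s X t" "walk E s' Y t'" "set X \<inter> set Y = {}" for X Y s t s' t'
  proof -
    have "e \<noteq> {}" if "e \<in> walk_edges xs" for e and xs :: "'a list"
      using that by (induction xs rule: walk_edges.induct) auto
    then have "walk_edges X \<inter> walk_edges Y = {}"
      using \<open>set X \<inter> set Y = {}\<close> walk_edges_subset by fast
    then show ?thesis
      using drawn_Int_subset[OF D, of X Y] that by (auto simp: walk_def)
  qed
  show False
  proof (rule no_theta_curve_with_tripod[OF f(1) g(1) h(1), of "drawn \<gamma> P" "\<phi> c" "drawn \<gamma> Q" "drawn \<gamma> R"])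
    show "drawn \<gamma> P \<inter> path_image f \<noteq> {}"
      using vertices[OF P(1), of x] vertices[OF A(1) P(2)] walk_ends_in_set[OF P(1)] f(2) by auto
    show "drawn \<gamma> Q \<inter> path_image g \<noteq> {}"
      using vertices[OF Q(1), of y] vertices[OF B(1) Q(2)] walk_ends_in_set[OF Q(1)] g(2) by auto
    show "drawn \<gamma> R \<inter> path_image h \<noteq> {}"
      using vertices[OF R(1), of z] vertices[OF C(1) R(2)] walk_ends_in_set[OF R(1)] h(2) by auto
    show "drawn \<gamma> P \<inter> (path_image g \<union> path_image h) = {}"
      using disjoint[OF P(1) B(1)] disjoint[OF P(1) C(1)] P(3) g h by auto
    show "drawn \<gamma> Q \<inter> (path_image h \<union> path_image f) = {}"
      using disjoint[OF Q(1) C(1)] disjoint[OF Q(1) A(1)] Q(3) f h by auto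
    show "drawn \<gamma> R \<inter> (path_image f \<union> path_image g) = {}"
      using disjoint[OF R(1) A(1)] disjoint[OF R(1) B(1)] R(3) f g by auto
  qed (use theta[OF A(1) B(1) AB] theta[OF B(1) C(1) BC] theta[OF C(1) A(1) CA] f g h
      drawn_walk_connected(1)[OF D] vertices[OF P(1)] vertices[OF Q(1)] vertices[OF R(1)]
      walk_ends_in_set[OF P(1)] walk_ends_in_set[OF Q(1)] walk_ends_in_set[OF R(1)] P(1) Q(1) R(1)
      in simp_all)
qed


section \<open>Square roots of minus one\<close>

text \<open>
  By Euler's criterion the Legendre symbol of \<open>-1\<close> is \<open>(-1)\<close> to the power
  \<open>(p - 1) / 2\<close>, and this exponent is even.
\<close>
lemma minus_one_quadratic_residue:
  fixes p :: nat
  assumes "prime p" and "[p = 1] (mod 4)"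
  shows "QuadRes (int p) (- 1)"
proof -
  have p: "p mod 4 = 1"
    using assms(2) by (simp add: cong_def)
  then have "p \<noteq> 2"
    by auto
  then have "2 < p"
    using prime_ge_2_nat[OF assms(1)] by simp
  have "even ((p - 1) div 2)"
    using p by presburger
  then have "[Legendre (- 1) (int p) = 1] (mod int p)"
    using euler_criterion[OF assms(1) \<open>2 < p\<close>, of "- 1"] by simp
  moreover have "\<not> [0 = 1] (mod int p)" "\<not> [- 1 = 1] (mod int p)"
    using \<open>2 < p\<close> zdvd_not_zless[of 2 "int p"] by (auto simp: cong_iff_dvd_diff)
  ultimately show ?thesis
    by (auto simp: Legendre_def split: if_splits)
qed

lemma residue_ring_sqrt_minus_one:
  fixes p :: nat
  defines "R \<equiv> residue_ring (int p)"
  assumes "prime p" and "[p = 1] (mod 4)"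
  obtains i where "i \<in> carrier R" and "i \<otimes>\<^bsub>R\<^esub> i = \<ominus>\<^bsub>R\<^esub> \<one>\<^bsub>R\<^esub>"
proof -
  interpret residues_prime p R
    by unfold_locales (use assms in auto)
  obtain y where "[y\<^sup>2 = - 1] (mod int p)"
    using minus_one_quadratic_residue[OF assms(2,3)] unfolding QuadRes_def by blast
  then have "(y * y) mod int p = (- 1) mod int p"
    by (simp add: cong_def power2_eq_square)
  then have "(y mod int p) \<otimes>\<^bsub>R\<^esub> (y mod int p) = \<ominus>\<^bsub>R\<^esub> \<one>\<^bsub>R\<^esub>"
    by (simp add: mult_cong res_neg_eq res_one_eq)
  then show thesis
    by (intro that[of "y mod int p"]) simp_all
qed


section \<open>A nonplanar subgraph with twelve vertices\<close>

lemma markoff_edge: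
  assumes "v \<in> markoff_verts R" and "m \<in> {markoff_m1 R, markoff_m2 R, markoff_m3 R}"
    and "m v = w" and "v \<noteq> w"
  shows "{v, w} \<in> {e \<in> markoff_edges R. card e = 2}"
proof -
  have "{v, w} \<in> markoff_edges R"
    using assms(1-3) unfolding markoff_edges_def by blast
  then show ?thesis
    using assms(4) by simp
qed

text \<open>
  The vertices \<open>a\<^sub>k\<close>, \<open>c\<^sub>k\<close>, \<open>b\<^sub>k\<close> are \<open>(s, ti, 0)\<close>, \<open>(s, ti, sti)\<close>,
  \<open>(s, 0, sti)\<close> with \<open>(s, t) = (1, 1), (1, -1), (-1, -1), (-1, 1)\<close> for \<open>k = 1, 2, 3, 4\<close>.
  The first square is \<open>a\<^sub>1a\<^sub>2a\<^sub>3a\<^sub>4\<close>, but the second is \<open>b\<^sub>1b\<^sub>2b\<^sub>4b\<^sub>3\<close>. Without the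
  side \<open>a\<^sub>1a\<^sub>2\<close> this is a subdivided \<open>K\<^bsub>3,3\<^esub>\<close> with the branch vertices
  \<open>a\<^sub>3, b\<^sub>1, b\<^sub>4\<close> on one side and \<open>a\<^sub>4, b\<^sub>2, b\<^sub>3\<close> on the other.
\<close>
lemma (in cring) markoff_graph_not_planar:
  assumes i: "i \<in> carrier R" "i \<otimes> i = \<ominus> \<one>" and char: "\<one> \<noteq> \<ominus> \<one>"
  shows "\<not> planar_graph (markoff_verts R) (markoff_edges R)"
proof -
  have "\<zero> \<noteq> \<ominus> \<one>"
    using char by (metis minus_zero minus_minus one_closed)
  have i0: "i \<noteq> \<zero>"
    using i(2) \<open>\<zero> \<noteq> \<ominus> \<one>\<close> by auto
  then have j0: "\<ominus> i \<noteq> \<zero>"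
    using i(1) by (metis minus_minus minus_zero)
  have "i \<noteq> \<ominus> i"
  proof
    assume "i = \<ominus> i"
    then have "i \<otimes> i = \<ominus> (i \<otimes> i)"
      using i(1) by (metis l_minus)
    then show False
      using i(2) char by (metis minus_minus one_closed)
  qed
  note neq = char char[symmetric] i0 i0[symmetric] j0 j0[symmetric] this this[symmetric]
  define a1 a2 a3 a4 where
    a: "a1 = (\<one>, i, \<zero>)" "a2 = (\<one>, \<ominus> i, \<zero>)" "a3 = (\<ominus> \<one>, \<ominus> i, \<zero>)" "a4 = (\<ominus> \<one>, i, \<zero>)"
  define b1 b2 b3 b4 where
    b: "b1 = (\<one>, \<zero>, i)" "b2 = (\<one>, \<zero>, \<ominus> i)" "b3 = (\<ominus> \<one>, \<zero>, i)" "b4 = (\<ominus> \<one>, \<zero>, \<ominus> i)"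
  define c1 c2 c3 c4 where
    c: "c1 = (\<one>, i, i)" "c2 = (\<one>, \<ominus> i, \<ominus> i)" "c3 = (\<ominus> \<one>, \<ominus> i, i)" "c4 = (\<ominus> \<one>, i, \<ominus> i)"
  have distinct: "distinct [a1, a2, a3, a4, b1, b2, b3, b4, c1, c2, c3, c4]"
    by (simp add: a b c neq)
  \<comment> \<open>These rules evaluate all products and sums of \<open>0\<close>, \<open>\<plusminus>1\<close>, \<open>\<plusminus>i\<close> that occur below.\<close>
  note arith = minus_eq l_minus r_minus l_neg r_neg numeral_2_eq_2 i
  have verts: "v \<in> markoff_verts R"
    if "v \<in> {a1, a2, a3, a4, b1, b2, b3, b4, c1, c2, c3, c4}" for v
    using that unfolding markoff_verts_def
    by (elim insertE emptyE) (simp_all add: a b c arith neq)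
  let ?E = "{e \<in> markoff_edges R. card e = 2}"
  have edge: "{v, w} \<in> ?E"
    if "v \<in> {a1, a2, a3, a4, b1, b2, b3, b4, c1, c2, c3, c4}" "v \<noteq> w"
      "w \<in> {markoff_m1 R v, markoff_m2 R v, markoff_m3 R v}" for v w
    using markoff_edge[OF verts[OF that(1)], of _ w] that(2,3) by auto
  have edges: "{a3, a4} \<in> ?E" "{a4, a1} \<in> ?E" "{a1, c1} \<in> ?E" "{c1, b1} \<in> ?E"
    "{a3, a2} \<in> ?E" "{a2, c2} \<in> ?E" "{c2, b2} \<in> ?E" "{b2, b1} \<in> ?E"
    "{a3, c3} \<in> ?E" "{c3, b3} \<in> ?E" "{b3, b1} \<in> ?E"
    "{b4, c4} \<in> ?E" "{c4, a4} \<in> ?E" "{b4, b2} \<in> ?E" "{b4, b3} \<in> ?E"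
    by (rule edge; simp add: a b c arith neq)+
  have "\<not> plane_drawing (markoff_verts R) ?E \<phi> \<gamma>" for \<phi> \<gamma>
    \<comment> \<open>A theta graph from \<open>a3\<close> to \<open>b1\<close> through \<open>a4\<close>, \<open>b2\<close>, \<open>b3\<close>, and the tripod at \<open>b4\<close>.\<close>
  proof (rule not_planar_if_theta_with_tripod
      [of ?E a3 "[a3, a4, a1, c1, b1]" b1 "[a3, a2, c2, b2, b1]" "[a3, c3, b3, b1]"
          b4 "[b4, c4, a4]" a4 "[b4, b2]" b2 "[b4, b3]" b3])
  qed (use distinct distinct_rev[THEN iffD2, OF distinct] in \<open>simp_all add: walk_def edges doubleton_eq_iff del: mem_Collect_eq\<close>)
  then show ?thesis
    unfolding planar_graph_def by blast
qed

theorem theorem1p4: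
  fixes p :: nat
  assumes "prime p" and "[p = 1] (mod 4)"
  shows "\<not> planar_graph (markoff_verts (residue_ring (int p))) (markoff_edges (residue_ring (int p)))"
proof -
  define R where "R = residue_ring (int p)"
  interpret residues_prime p R
    by unfold_locales (use assms in \<open>auto simp: R_def\<close>)
  obtain i where "i \<in> carrier R" "i \<otimes>\<^bsub>R\<^esub> i = \<ominus>\<^bsub>R\<^esub> \<one>\<^bsub>R\<^esub>"
    using residue_ring_sqrt_minus_one[OF assms] unfolding R_def by blast
  moreover have "\<one>\<^bsub>R\<^esub> \<noteq> \<ominus>\<^bsub>R\<^esub> \<one>\<^bsub>R\<^esub>"
  proof
    assume "\<one>\<^bsub>R\<^esub> = \<ominus>\<^bsub>R\<^esub> \<one>\<^bsub>R\<^esub>"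
    then have "p = 2"
      using one_eq_neg_one by simp
    then show False
      using assms(2) by (simp add: cong_def)
  qed
  ultimately show ?thesis
    using markoff_graph_not_planar unfolding R_def by blast
qed

end
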